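(* Let $B$ be an abelian group (written additively) and let $\sigma_B,\delta_B\colon B\to B$ be group endomorphisms. For all $j,k,n\in\mathbb{N}$, $$\sum_{i\in\mathbb{N}} \pi_i^k\circ\pi_{j-i}^n=\pi_j^{k+n}$$ as maps $B\to B$.
   Context: $\mathbb{N}=\{0,1,2,\ldots\}$. For $i,j\in\mathbb{N}$ with $i\ge j$, $\pi_j^i\colon B\to B$ denotes the sum of all $\binom{i}{j}$ compositions of $j$ instances of $\sigma_B$ and $i-j$ instances of $\delta_B$ (one composition for each word of length $i$ with exactly $j$ letters $\sigma_B$ and $i-j$ letters $\delta_B$; $\pi_0^0=\mathrm{id}_B$). If $i<j$, then $\pi_j^i=0$. A map $\pi_j^i$ with negative lower index $j$ is understood to be $0$, so the sum above is finite. *)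

theory Defs
  imports
    Main
    "HOL.Modules"
    "HOL-Library.Function_Algebras"
    "HOL-Library.Groups_Big_Fun"
begin

datatype letter = Sigma_letter | Delta_letter

definition words :: "nat \<Rightarrow> nat \<Rightarrow> letter list set" where
  "words i j = {w. length w = i \<and> count_list w Sigma_letter = j}"

fun word_map :: "('b \<Rightarrow> 'b) \<Rightarrow> ('b \<Rightarrow> 'b) \<Rightarrow> letter list \<Rightarrow> 'b \<Rightarrow> 'b" where
  "word_map \<sigma> \<delta> [] = id"
| "word_map \<sigma> \<delta> (Sigma_letter # w) = \<sigma> \<circ> word_map \<sigma> \<delta> w"
| "word_map \<sigma> \<delta> (Delta_letter # w) = \<delta> \<circ> word_map \<sigma> \<delta> w"

(* The upper index comes first: pi_map \<sigma> \<delta> i j is \<pi>\<^sub>j\<^sup>i. The lower index is an integer, so that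
   j - i is never truncated. Sums and 0 on maps are pointwise (Function_Algebras); the sum ranges
   over words, so words that induce equal maps are counted separately. *)
definition pi_map :: "('b::ab_group_add \<Rightarrow> 'b) \<Rightarrow> ('b \<Rightarrow> 'b) \<Rightarrow> nat \<Rightarrow> int \<Rightarrow> 'b \<Rightarrow> 'b" where
  "pi_map \<sigma> \<delta> i j =
     (if 0 \<le> j \<and> j \<le> int i then (\<Sum>w\<in>words i (nat j). word_map \<sigma> \<delta> w) else 0)"

lemma words_0: "words 0 j = (if j = 0 then {[]} else {})"
  by (auto simp: words_def)

lemma words_Suc:
  "words (Suc i) j =
     (#) Delta_letter ` words i j \<union> (case j of 0 \<Rightarrow> {} | Suc j' \<Rightarrow> (#) Sigma_letter ` words i j')"
proof (intro set_eqI iffI)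
  fix w assume "w \<in> words (Suc i) j"
  then obtain l v where "w = l # v" "length v = i" "count_list (l # v) Sigma_letter = j"
    by (auto simp: words_def length_Suc_conv)
  then show "w \<in> (#) Delta_letter ` words i j
      \<union> (case j of 0 \<Rightarrow> {} | Suc j' \<Rightarrow> (#) Sigma_letter ` words i j')"
    by (cases l) (auto simp: words_def)
qed (auto simp: words_def split: nat.splits)

lemma finite_words: "finite (words i j)"
  by (induction i arbitrary: j) (auto simp: words_0 words_Suc split: nat.splits)

lemma card_words: "card (words i j) = i choose j"
proof (induction i arbitrary: j)
  case 0
  then show ?case by (cases j) (auto simp: words_0)
next
  case (Suc i)
  show ?case
  proof (cases j)
    case 0
    then show ?thesis using Suc[of 0] by (simp add: words_Suc card_image)
  next
    case (Suc j')
    have "card (words (Suc i) j) = card ((#) Delta_letter ` words i j)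
        + card ((#) Sigma_letter ` words i j')"
      unfolding words_Suc Suc by (simp, subst card_Un_disjoint) (auto simp: finite_words)
    then show ?thesis using Suc.IH by (simp add: card_image Suc)
  qed
qed

lemma pi_map_0_0: "pi_map \<sigma> \<delta> 0 0 = id"
  by (simp add: pi_map_def words_0)

(* Sum_any is 0 by convention when infinitely many terms are nonzero; this does not happen for the
   sum of \<pi>\<^sub>i\<^sup>k \<circ> \<pi>\<^sub>j\<^sub>-\<^sub>i\<^sup>n over all natural numbers i. *)
lemma finite_support:
  fixes \<sigma> \<delta> :: "'b::ab_group_add \<Rightarrow> 'b" and j :: int
  shows "finite {i::nat. pi_map \<sigma> \<delta> k (int i) \<circ> pi_map \<sigma> \<delta> n (j - int i) \<noteq> 0}"
proof (rule finite_subset)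
  show "{i::nat. pi_map \<sigma> \<delta> k (int i) \<circ> pi_map \<sigma> \<delta> n (j - int i) \<noteq> 0} \<subseteq> {..k}"
    by (auto simp: pi_map_def fun_eq_iff not_le)
qed simp

end

theory Submission
  imports Defs
begin

text \<open>
  Splitting a word of length \<open>k + n\<close> with \<open>j\<close> letters \<open>\<sigma>\<close> after its first \<open>k\<close> letters gives a pair
  of words of lengths \<open>k\<close> and \<open>n\<close> whose numbers of letters \<open>\<sigma>\<close> add up to \<open>j\<close>. Since all word maps
  are additive, the left-hand side expands to the sum over all these pairs.
\<close>

lemma bij_betw_append_words:
  "bij_betw (\<lambda>(i, w, v). w @ v) (SIGMA i:{..j}. words k i \<times> words n (j - i)) (words (k + n) j)"
proof -
  have split: "count_list (take k u) a + count_list (drop k u) a = count_list u a"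
    for u :: "letter list" and a
    by (simp flip: count_list_append)
  have le: "count_list (take k u) a \<le> count_list u a" for u :: "letter list" and a
    by (simp flip: split[of u a])
  have diff: "count_list (drop k u) a = count_list u a - count_list (take k u) a"
    for u :: "letter list" and a
    by (simp flip: split[of u a])
  show ?thesis
    \<comment> \<open>The inverse cuts \<open>u\<close> after \<open>k\<close> letters; the index
      \<open>i\<close> is recovered as the number of \<sigma> in the prefix.\<close>
    by (rule bij_betw_byWitness[where f' =
          "\<lambda>u. (count_list (take k u) Sigma_letter, take k u, drop k u)"])
       (auto simp: words_def le diff)
qed

lemma word_map_append: "word_map \<sigma> \<delta> (w @ v) = word_map \<sigma> \<delta> w \<circ> word_map \<sigma> \<delta> v"
  by (induction \<sigma> \<delta> w rule: word_map.induct) (simp_all add: o_assoc)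

lemma additive_word_map:
  assumes "additive \<sigma>" and "additive \<delta>"
  shows "additive (word_map \<sigma> \<delta> w)"
  using assms by (induction \<sigma> \<delta> w rule: word_map.induct) (auto simp: additive_def)

lemma sum_fun_apply: "(\<Sum>a\<in>A. f a) x = (\<Sum>a\<in>A. f a x)"
  by (induction A rule: infinite_finite_induct) auto

text \<open>For \<open>i > k\<close> the set \<open>words k i\<close> has binomial cardinality 0, so
  the sum over it is empty and agrees with the default value 0 of \<open>pi_map\<close>.\<close>

lemma pi_map_of_nat: "pi_map \<sigma> \<delta> k (int i) x = (\<Sum>w\<in>words k i. word_map \<sigma> \<delta> w x)"
proof (cases "i \<le> k")
  case False
  then have "words k i = {}"
    using card_words[of k i] finite_words[of k i] by (simp add: binomial_eq_0)
  with False show ?thesis by (simp add: pi_map_def)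
qed (simp add: pi_map_def sum_fun_apply)

theorem proposition21:
  fixes \<sigma> \<delta> :: "'b::ab_group_add \<Rightarrow> 'b" and j k n :: nat
  assumes "additive \<sigma>" and "additive \<delta>"
  shows "(\<Sum>i::nat. pi_map \<sigma> \<delta> k (int i) \<circ> pi_map \<sigma> \<delta> n (int j - int i))
           = pi_map \<sigma> \<delta> (k + n) (int j)"
proof
  fix x
  note additive = additive_word_map[OF assms]
  \<comment> \<open>The inner map has a negative lower index, hence is 0, and the outer word maps
    send 0 to 0 by additivity.\<close>
  have "pi_map \<sigma> \<delta> k (int i) \<circ> pi_map \<sigma> \<delta> n (int j - int i) = 0" if "j < i" for i
    using that by (simp add: fun_eq_iff pi_map_of_nat additive.zero[OF additive])
      (simp add: pi_map_def additive.zero[OF additive])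
  then have "{i. pi_map \<sigma> \<delta> k (int i) \<circ> pi_map \<sigma> \<delta> n (int j - int i) \<noteq> 0} \<subseteq> {..j}"
    using not_le by auto
  \<comment> \<open>With the support inside \<open>{..j}\<close>, the sum over all naturals becomes
    finite, and there the integer difference is the natural number \<open>j - i\<close>.\<close>
  then have "(\<Sum>i::nat. pi_map \<sigma> \<delta> k (int i) \<circ> pi_map \<sigma> \<delta> n (int j - int i)) x
      = (\<Sum>i\<le>j. pi_map \<sigma> \<delta> k (int i) (pi_map \<sigma> \<delta> n (int (j - i)) x))"
    by (simp add: Sum_any.expand_superset[of "{..j}"] sum_fun_apply of_nat_diff)
  \<comment> \<open>Additivity of the outer map \<open>word_map \<sigma> \<delta> w\<close> moves it
    inside the sum over \<open>v\<close>.\<close>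
  also have "\<dots> = (\<Sum>i\<le>j. \<Sum>(w, v)\<in>words k i \<times> words n (j - i). word_map \<sigma> \<delta> (w @ v) x)"
    by (simp only: pi_map_of_nat additive.sum[OF additive] sum.cartesian_product
        word_map_append o_apply)
  also have "\<dots> = (\<Sum>(i, w, v)\<in>(SIGMA i:{..j}. words k i \<times> words n (j - i)).
      word_map \<sigma> \<delta> (w @ v) x)"
    by (subst sum.Sigma) (auto simp: finite_words)
  also have "\<dots> = (\<Sum>u\<in>words (k + n) j. word_map \<sigma> \<delta> u x)"
    using sum.reindex_bij_betw[OF bij_betw_append_words, of "\<lambda>u. word_map \<sigma> \<delta> u x"]
    by (simp add: case_prod_unfold)
  finally show "(\<Sum>i::nat. pi_map \<sigma> \<delta> k (int i) \<circ> pi_map \<sigma> \<delta> n (int j - int i)) x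
      = pi_map \<sigma> \<delta> (k + n) (int j) x"
    by (simp only: pi_map_of_nat)
qed

end
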